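(* Let $n\ge 2$, let $z_1,z_2,\ldots,z_n\in\mathbb{C}$, and let $\gamma=(\gamma_1,\ldots,\gamma_n)$ be nonnegative real numbers with $\sum_{k=1}^n\gamma_k=1$. Let $A_n(z)=\prod_{j=1}^n(z-z_j)$ and $B_n(z)=\prod_{j=1}^n(z-|z_j|)$. Let $w_1,\ldots,w_{n-1}$ denote the zeros (counted with multiplicity) of $A_n^\gamma(z)$ listed in descending order of modulus, and let $v_1,\ldots,v_{n-1}$ denote the zeros (counted with multiplicity) of $B_n^\gamma(z)$ listed in descending order. Then $$\prod_{j=1}^k|w_j|\le\prod_{j=1}^k|v_j|,\qquad\text{for }1\le k\le n-1.$$
   Context: For nonnegative reals $\gamma=(\gamma_1,\ldots,\gamma_n)$ with $\sum_{k=1}^n\gamma_k=1$, the convex combinations of incomplete polynomials are $A_n^\gamma(z)=\sum_{k=1}^n\gamma_k\prod_{j=1,\,j\ne k}^n(z-z_j)$ and $B_n^\gamma(z)=\sum_{k=1}^n\gamma_k\prod_{j=1,\,j\ne k}^n(z-|z_j|)$ (same $\gamma$, same indexing of the $z_j$); both are monic of degree $n-1$. The zeros of $B_n^\gamma$ lie in the convex hull of $|z_1|,\ldots,|z_n|$, hence are nonnegative reals, so listing them in descending order makes sense. *)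

theory Defs
  imports "HOL-Analysis.Analysis" "HOL-Computational_Algebra.Fundamental_Theorem_Algebra"
begin

text \<open>
  The convex combination \<open>A\<^sub>n\<^sup>\<gamma>\<close> of the incomplete polynomials of \<open>\<Prod>j = 1..n. (x - z j)\<close>.
  \<open>B\<^sub>n\<^sup>\<gamma>\<close> is the same construction applied to the moduli \<open>\<lambda>j. of_real (cmod (z j))\<close>.
\<close>

definition incomplete_comb :: "nat \<Rightarrow> (nat \<Rightarrow> real) \<Rightarrow> (nat \<Rightarrow> complex) \<Rightarrow> complex poly" where
  "incomplete_comb n \<gamma> z =
     (\<Sum>k = 1..n. smult (of_real (\<gamma> k)) (\<Prod>j \<in> {1..n} - {k}. [:- z j, 1:]))"

definition zeros_listing :: "complex poly \<Rightarrow> nat \<Rightarrow> (nat \<Rightarrow> complex) \<Rightarrow> bool" where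
  "zeros_listing p m u \<longleftrightarrow> proots p = image_mset u (mset_set {1..m})"

text \<open>
  The rest shows that \<open>A\<^sub>n\<^sup>\<gamma>\<close> and \<open>B\<^sub>n\<^sup>\<gamma>\<close> are monic of degree \<open>n - 1\<close> and that the zeros of
  \<open>B\<^sub>n\<^sup>\<gamma>\<close> are nonnegative reals, so that listings as required in the theorem always exist;
  in particular it is no restriction that the zeros of \<open>B\<^sub>n\<^sup>\<gamma>\<close> are listed by a real sequence.
\<close>

lemma incomplete_comb_monic:
  assumes "n \<ge> 1" and g1: "(\<Sum>k = 1..n. \<gamma> k) = 1"
  shows "degree (incomplete_comb n \<gamma> z) = n - 1"
    and "lead_coeff (incomplete_comb n \<gamma> z) = 1"
    and "incomplete_comb n \<gamma> z \<noteq> 0"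
proof -
  let ?q = "\<lambda>k. \<Prod>j \<in> {1..n} - {k}. [:- z j, 1:]"
  have dq: "degree (?q k) = n - 1" if "k \<in> {1..n}" for k
    using that by (subst degree_prod_sum_eq) auto
  have lq: "coeff (?q k) (n - 1) = 1" if "k \<in> {1..n}" for k
    using lead_coeff_prod[of "\<lambda>j. [:- z j, 1:]" "{1..n} - {k}"] dq[OF that] by simp
  have c: "coeff (incomplete_comb n \<gamma> z) (n - 1) = 1"
  proof -
    have "coeff (incomplete_comb n \<gamma> z) (n - 1)
        = (\<Sum>k = 1..n. complex_of_real (\<gamma> k) * coeff (?q k) (n - 1))"
      by (simp add: incomplete_comb_def coeff_sum)
    also have "\<dots> = (\<Sum>k = 1..n. complex_of_real (\<gamma> k))"
      by (intro sum.cong refl) (simp only: lq mult_1_right)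
    finally show ?thesis using g1 by (simp flip: of_real_sum)
  qed
  have "degree (incomplete_comb n \<gamma> z) \<le> n - 1"
    unfolding incomplete_comb_def
    by (intro degree_sum_le) (use dq in \<open>force intro!: order_trans[OF degree_smult_le]\<close>)+
  moreover have "degree (incomplete_comb n \<gamma> z) \<ge> n - 1"
    using c by (intro le_degree) simp
  ultimately show d: "degree (incomplete_comb n \<gamma> z) = n - 1" by simp
  show "lead_coeff (incomplete_comb n \<gamma> z) = 1" using c d by simp
  show "incomplete_comb n \<gamma> z \<noteq> 0" using c by auto
qed

lemma incomplete_comb_moduli_zero:
  assumes "n \<ge> 1" and g0: "\<And>k. k \<in> {1..n} \<Longrightarrow> \<gamma> k \<ge> 0" and g1: "(\<Sum>k = 1..n. \<gamma> k) = 1"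
    and x: "poly (incomplete_comb n \<gamma> (\<lambda>j. of_real (cmod (z j)))) x = 0"
  shows "x \<in> \<real> \<and> Re x \<ge> 0"
proof (cases "\<exists>k\<in>{1..n}. x = of_real (cmod (z k))")
  case True
  then show ?thesis by auto
next
  case False
  let ?r = "\<lambda>k. cmod (z k)"
  let ?d = "\<lambda>k. x - of_real (?r k)"
  let ?P = "\<Prod>j = 1..n. ?d j"
  have nz: "?d k \<noteq> 0" if "k \<in> {1..n}" for k using False that by auto
  have "0 = (\<Sum>k = 1..n. of_real (\<gamma> k) * (\<Prod>j \<in> {1..n} - {k}. ?d j))"
    using x by (simp add: incomplete_comb_def poly_sum poly_prod)
  also have "\<dots> = (\<Sum>k = 1..n. ?P * (of_real (\<gamma> k) / ?d k))"
  proof (intro sum.cong refl)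
    fix k assume k: "k \<in> {1..n}"
    have "?P = ?d k * (\<Prod>j \<in> {1..n} - {k}. ?d j)"
      using k by (intro prod.remove) auto
    then show "of_real (\<gamma> k) * (\<Prod>j \<in> {1..n} - {k}. ?d j) = ?P * (of_real (\<gamma> k) / ?d k)"
      using nz[OF k] by simp
  qed
  also have "\<dots> = ?P * (\<Sum>k = 1..n. of_real (\<gamma> k) / ?d k)"
    by (simp add: sum_distrib_left)
  finally have s0: "(\<Sum>k = 1..n. of_real (\<gamma> k) / ?d k) = 0"
    using nz by (auto simp: prod_zero_iff)
  obtain k0 where k0: "k0 \<in> {1..n}" "\<gamma> k0 > 0"
  proof -
    have "\<exists>k\<in>{1..n}. \<gamma> k \<noteq> 0"
      using g1 by (metis sum.neutral zero_neq_one)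
    then show ?thesis using that g0 by (metis less_eq_real_def)
  qed
  have pos: "(\<Sum>k = 1..n. \<gamma> k * (h k / (cmod (?d k))\<^sup>2)) > 0"
    if h: "\<And>k. k \<in> {1..n} \<Longrightarrow> h k > 0" for h :: "nat \<Rightarrow> real"
  proof (rule sum_pos2[OF _ k0(1)])
    show "0 < \<gamma> k0 * (h k0 / (cmod (?d k0))\<^sup>2)"
      using k0 h[OF k0(1)] nz[OF k0(1)] by simp
    show "0 \<le> \<gamma> k * (h k / (cmod (?d k))\<^sup>2)" if "k \<in> {1..n}" for k
      using g0[OF that] h[OF that] by simp
  qed simp
  have im: "Im x = 0"
  proof -
    have "0 = Im (\<Sum>k = 1..n. of_real (\<gamma> k) / ?d k)" using s0 by simp
    also have "\<dots> = (\<Sum>k = 1..n. - Im x * (\<gamma> k * (1 / (cmod (?d k))\<^sup>2)))"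
      unfolding Im_sum by (intro sum.cong refl) (simp add: Im_divide cmod_power2)
    also have "\<dots> = - Im x * (\<Sum>k = 1..n. \<gamma> k * (1 / (cmod (?d k))\<^sup>2))"
      by (simp only: sum_distrib_left)
    finally show ?thesis using pos[of "\<lambda>_. 1"] by simp
  qed
  have "\<not> Re x < 0"
  proof
    assume neg: "Re x < 0"
    have "0 = Re (\<Sum>k = 1..n. of_real (\<gamma> k) / ?d k)" using s0 by simp
    also have "\<dots> = (\<Sum>k = 1..n. - (\<gamma> k * ((?r k - Re x) / (cmod (?d k))\<^sup>2)))"
      unfolding Re_sum
      by (intro sum.cong refl) (simp add: Re_divide cmod_power2 minus_divide_left algebra_simps)
    also have "\<dots> = - (\<Sum>k = 1..n. \<gamma> k * ((?r k - Re x) / (cmod (?d k))\<^sup>2))"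
      by (simp only: sum_negf)
    finally show False using pos[of "\<lambda>k. ?r k - Re x"] neg
      by (smt (verit) norm_ge_zero)
  qed
  with im show ?thesis by (simp add: complex_is_Real_iff)
qed

lemma multiset_descending_listing:
  fixes f :: "'a \<Rightarrow> real"
  assumes "size M = m"
  obtains u where "M = image_mset u (mset_set {1..m})"
    and "\<And>i j. 1 \<le> i \<Longrightarrow> i \<le> j \<Longrightarrow> j \<le> m \<Longrightarrow> f (u j) \<le> f (u i)"
proof -
  obtain ys where ys: "mset ys = M" using ex_mset by blast
  define xs where "xs = sort_key (\<lambda>a. - f a) ys"
  define u where "u i = xs ! (i - 1)" for i
  have xs: "mset xs = M" "sorted (map (\<lambda>a. - f a) xs)" "length xs = m"
    using ys assms by (auto simp: xs_def)
  have "xs = map u [1..<m + 1]"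
    using xs(3) by (intro nth_equalityI) (auto simp: u_def simp del: upt_Suc)
  then have "M = image_mset u (mset [1..<m + 1])"
    using xs(1) by (metis mset_map)
  also have "mset [1..<m + 1] = mset_set {1..m}"
    by (metis Suc_eq_plus1 atLeastLessThanSuc_atLeastAtMost mset_upt)
  finally have 1: "M = image_mset u (mset_set {1..m})" .
  have 2: "f (u j) \<le> f (u i)" if "1 \<le> i" "i \<le> j" "j \<le> m" for i j
    using sorted_nth_mono[OF xs(2), of "i - 1" "j - 1"] that xs(3) by (simp add: u_def)
  show thesis using that 1 2 by blast
qed

lemma zeros_listing_exists:
  assumes "n \<ge> 1" and "(\<Sum>k = 1..n. \<gamma> k) = 1"
  shows "\<exists>w. zeros_listing (incomplete_comb n \<gamma> z) (n - 1) w \<and>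
           (\<forall>i j. 1 \<le> i \<and> i \<le> j \<and> j \<le> n - 1 \<longrightarrow> cmod (w j) \<le> cmod (w i))"
proof -
  have "size (proots (incomplete_comb n \<gamma> z)) = n - 1"
    using incomplete_comb_monic[OF assms] by (simp add: size_proots_complex)
  from multiset_descending_listing[OF this, of cmod] show ?thesis
    unfolding zeros_listing_def by metis
qed

lemma zeros_listing_moduli_exists:
  assumes "n \<ge> 1" and "\<And>k. k \<in> {1..n} \<Longrightarrow> \<gamma> k \<ge> 0" and "(\<Sum>k = 1..n. \<gamma> k) = 1"
  shows "\<exists>v :: nat \<Rightarrow> real.
           zeros_listing (incomplete_comb n \<gamma> (\<lambda>j. of_real (cmod (z j)))) (n - 1)
             (\<lambda>j. of_real (v j)) \<and>
           (\<forall>i j. 1 \<le> i \<and> i \<le> j \<and> j \<le> n - 1 \<longrightarrow> v j \<le> v i)"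
proof -
  let ?B = "incomplete_comb n \<gamma> (\<lambda>j. of_real (cmod (z j)))"
  have "size (proots ?B) = n - 1"
    using incomplete_comb_monic[OF assms(1,3)] by (simp add: size_proots_complex)
  from multiset_descending_listing[OF this, of Re] obtain u where
    u: "proots ?B = image_mset u (mset_set {1..n - 1})"
      "\<And>i j. 1 \<le> i \<Longrightarrow> i \<le> j \<Longrightarrow> j \<le> n - 1 \<Longrightarrow> Re (u j) \<le> Re (u i)"
    by metis
  have "of_real (Re x) = x" if "x \<in># proots ?B" for x
    using that incomplete_comb_moduli_zero[OF assms]
      incomplete_comb_monic(3)[OF assms(1,3)] by simp
  then have "image_mset (\<lambda>x. of_real (Re x)) (proots ?B) = proots ?B"
    by (metis (no_types, lifting) multiset.map_cong0 multiset.map_ident)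
  then have "proots ?B = image_mset (\<lambda>j. of_real (Re (u j))) (mset_set {1..n - 1})"
    unfolding u(1) by (simp add: multiset.map_comp o_def)
  then show ?thesis
    using u(2) unfolding zeros_listing_def by (intro exI[of _ "\<lambda>j. Re (u j)"]) blast
qed

end

theory Submission
  imports Defs "Jordan_Normal_Form.Schur_Decomposition"
begin

text \<open>
  Let \<open>P\<close> be the orthogonal projection along the unit vector with entries \<open>sqrt (\<gamma> k)\<close> and \<open>D\<close> the
  diagonal matrix of the \<open>z j\<close>. The characteristic polynomial of \<open>P D P\<close> is \<open>x\<close> times
  \<open>A\<^sub>n\<^sup>\<gamma>\<close>, and that of \<open>P |D| P\<close> is \<open>x\<close> times \<open>B\<^sub>n\<^sup>\<gamma>\<close>. Let \<open>X\<close> consist of the first \<open>k\<close> columns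
  of \<open>P U\<close>, where the unitary matrix \<open>U\<close> triangularises \<open>P D P\<close> with the zeros in descending order.
  Then \<open>det (X* D X)\<close> is the product of the first \<open>k\<close> zeros. By Cauchy--Binet it is a combination,
  with nonnegative coefficients that do not depend on \<open>D\<close>, of products of \<open>k\<close> diagonal entries of \<open>D\<close>;
  hence its modulus is at most \<open>det (X* |D| X)\<close>. Diagonalising the Hermitian matrix \<open>P |D| P\<close> and
  applying Cauchy--Binet again bounds the latter by the product of the \<open>k\<close> largest eigenvalues of \<open>P |D| P\<close>.
\<close>

hide_const (open) Determinants.det Finite_Cartesian_Product.vec Finite_Cartesian_Product.row
  Finite_Cartesian_Product.mat Finite_Cartesian_Product.transpose
unbundle no vec_syntax and no inner_syntax

section \<open>Cauchy--Binet expansion and bounds for weighted Gram determinants\<close>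

text \<open>
  Cauchy--Binet for \<open>X* diag(d) X\<close>, summed over all index functions rather than over \<open>k\<close>-subsets:
  each subset is counted \<open>k!\<close> times, and functions that are not injective contribute zero.
\<close>
lemma det_weighted_gram:
  fixes X :: "nat \<Rightarrow> nat \<Rightarrow> complex"
  shows "fact k * det (mat k k (\<lambda>(i,j). \<Sum>a = 0..<n. cnj (X a i) * d a * X a j)) =
    (\<Sum>f \<in> {0..<k} \<rightarrow>\<^sub>E {0..<n}. (\<Prod>i = 0..<k. d (f i)) *
       of_real ((cmod (det (mat k k (\<lambda>(i,j). X (f i) j))))\<^sup>2))"
proof -
  let ?K = "{0..<k}" and ?F = "{0..<k} \<rightarrow>\<^sub>E {0..<n}"
  let ?S = "{p. p permutes ?K}"
  let ?G = "mat k k (\<lambda>(i,j). \<Sum>a = 0..<n. cnj (X a i) * d a * X a j)"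
  let ?X = "\<lambda>f. mat k k (\<lambda>(i,j). X (f i) j)"
  \<comment> \<open>Multilinearity: choosing one summand \<open>a\<close> for each row
    \<open>i\<close> gives an index function \<open>f\<close>, and the signed sum over
    \<open>p\<close> is then the Leibniz formula for the matrix formed by the rows
    \<open>f i\<close> of \<open>X\<close>.\<close>
  have expand: "det ?G = (\<Sum>f\<in>?F. (\<Prod>i\<in>?K. cnj (X (f i) i)) * (\<Prod>i\<in>?K. d (f i)) * det (?X f))"
  proof -
    have "det ?G = (\<Sum>p\<in>?S. signof p * (\<Prod>i\<in>?K. \<Sum>a = 0..<n. cnj (X a i) * d a * X a (p i)))"
      by (subst det_def'[of _ k]) (auto intro!: sum.cong prod.cong dest: permutes_in_image)
    also have "\<dots> = (\<Sum>p\<in>?S. signof p * (\<Sum>f\<in>?F. \<Prod>i\<in>?K. cnj (X (f i) i) * d (f i) * X (f i) (p i)))"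
      by (subst prod_sum_PiE) auto
    also have "\<dots> = (\<Sum>f\<in>?F. \<Sum>p\<in>?S. signof p * (\<Prod>i\<in>?K. cnj (X (f i) i) * d (f i) * X (f i) (p i)))"
      unfolding sum_distrib_left by (rule sum.swap)
    also have "\<dots> = (\<Sum>f\<in>?F. (\<Prod>i\<in>?K. cnj (X (f i) i)) * (\<Prod>i\<in>?K. d (f i)) * det (?X f))"
    proof (rule sum.cong[OF refl])
      fix f
      have "det (?X f) = (\<Sum>p\<in>?S. signof p * (\<Prod>i\<in>?K. X (f i) (p i)))"
        by (subst det_def'[of _ k]) (auto intro!: sum.cong prod.cong dest: permutes_in_image)
      then show "(\<Sum>p\<in>?S. signof p * (\<Prod>i\<in>?K. cnj (X (f i) i) * d (f i) * X (f i) (p i))) =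
          (\<Prod>i\<in>?K. cnj (X (f i) i)) * (\<Prod>i\<in>?K. d (f i)) * det (?X f)"
        by (simp add: sum_distrib_left prod.distrib ac_simps)
    qed
    finally show ?thesis .
  qed
  \<comment> \<open>Substituting \<open>f \<circ> q\<close> for \<open>f\<close> leaves the product
    of the weights unchanged and multiplies the determinant by the sign of \<open>q\<close>, so
    every \<open>q\<close> yields another expression for the same value.\<close>
  have permuted: "det ?G = (\<Sum>f\<in>?F. (\<Prod>i\<in>?K. d (f i)) * det (?X f) *
      (signof q * (\<Prod>i\<in>?K. cnj (X (f (q i)) i))))" if q: "q permutes ?K" for q
  proof -
    have "det ?G = (\<Sum>f\<in>?F. (\<Prod>i\<in>?K. cnj (X (f (q i)) i)) * (\<Prod>i\<in>?K. d (f (q i))) * det (?X (f \<circ> q)))"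
      unfolding expand
    proof (rule sum.reindex_bij_witness[where i = "\<lambda>f. f \<circ> q" and j = "\<lambda>f. f \<circ> Hilbert_Choice.inv q"])
      fix f assume f: "f \<in> ?F"
      show "f \<circ> Hilbert_Choice.inv q \<circ> q = f" "f \<circ> q \<circ> Hilbert_Choice.inv q = f"
        using permutes_inv_o[OF q] by (simp_all add: comp_assoc)
      show "f \<circ> q \<in> ?F" "f \<circ> Hilbert_Choice.inv q \<in> ?F"
        using f permutes_in_image[OF q] permutes_in_image[OF permutes_inv[OF q]]
          permutes_not_in[OF q] permutes_not_in[OF permutes_inv[OF q]]
        by (auto simp: PiE_iff extensional_def)
    qed (use permutes_inverses[OF q] in \<open>auto simp: o_def\<close>)
    also have "\<dots> = (\<Sum>f\<in>?F. (\<Prod>i\<in>?K. d (f i)) * det (?X f) *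
      (signof q * (\<Prod>i\<in>?K. cnj (X (f (q i)) i))))"
    proof (rule sum.cong[OF refl])
      fix f
      have "mat k k (\<lambda>(i,j). ?X f $$ (q i, j)) = ?X (f \<circ> q)"
        using permutes_in_image[OF q] by (intro eq_matI) auto
      then have "det (?X (f \<circ> q)) = signof q * det (?X f)"
        using det_permute_rows[OF _ q, of "?X f"] by simp
      moreover have "(\<Prod>i\<in>?K. d (f (q i))) = (\<Prod>i\<in>?K. d (f i))"
        using prod.permute[OF q, of "\<lambda>i. d (f i)"] by (simp add: o_def)
      ultimately show "(\<Prod>i\<in>?K. cnj (X (f (q i)) i)) * (\<Prod>i\<in>?K. d (f (q i))) * det (?X (f \<circ> q)) =
          (\<Prod>i\<in>?K. d (f i)) * det (?X f) * (signof q * (\<Prod>i\<in>?K. cnj (X (f (q i)) i)))"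
        by simp
    qed
    finally show ?thesis .
  qed
  \<comment> \<open>Summing these expressions over all \<open>q\<close> costs the factor
    \<open>fact k\<close> and assembles the conjugated products into
    \<open>cnj (det (?X f))\<close>, so that each coefficient becomes a squared modulus.\<close>
  have "fact k * det ?G = (\<Sum>q\<in>?S. det ?G)"
    using card_permutations[OF refl, of ?K] by simp
  also have "\<dots> = (\<Sum>q\<in>?S. \<Sum>f\<in>?F. (\<Prod>i\<in>?K. d (f i)) * det (?X f) *
      (signof q * (\<Prod>i\<in>?K. cnj (X (f (q i)) i))))"
    using permuted by (intro sum.cong) auto
  also have "\<dots> = (\<Sum>f\<in>?F. (\<Prod>i\<in>?K. d (f i)) * (det (?X f) *
      (\<Sum>q\<in>?S. signof q * (\<Prod>i\<in>?K. cnj (X (f (q i)) i)))))"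
    by (subst sum.swap) (simp add: sum_distrib_left mult.assoc)
  also have "\<dots> = (\<Sum>f\<in>?F. (\<Prod>i\<in>?K. d (f i)) * of_real ((cmod (det (?X f)))\<^sup>2))"
  proof (rule sum.cong[OF refl])
    fix f
    have "det (?X f) = (\<Sum>q\<in>?S. signof q * (\<Prod>i\<in>?K. X (f (q i)) i))"
      by (subst mat_det_left_def[of _ k]) (auto intro!: sum.cong prod.cong dest: permutes_in_image)
    then have "cnj (det (?X f)) = (\<Sum>q\<in>?S. signof q * (\<Prod>i\<in>?K. cnj (X (f (q i)) i)))"
      by (simp add: cnj_sum)
    then show "(\<Prod>i\<in>?K. d (f i)) * (det (?X f) *
        (\<Sum>q\<in>?S. signof q * (\<Prod>i\<in>?K. cnj (X (f (q i)) i)))) =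
      (\<Prod>i\<in>?K. d (f i)) * of_real ((cmod (det (?X f)))\<^sup>2)"
      by (metis complex_norm_square)
  qed
  finally show ?thesis .
qed

text \<open>Induction on the cardinality, splitting off the largest index: a set of
  \<open>Suc k\<close> naturals has maximum at least \<open>k\<close>, so the factor at the maximum
  is at most \<open>e k\<close>. The index \<open>i\<close> may lie outside \<open>S\<close>, which
  is what permits a comparison with the initial segment.\<close>

lemma prod_le_prod_initial:
  fixes e :: "nat \<Rightarrow> real"
  assumes "finite S" and "\<And>i j. i \<le> j \<Longrightarrow> j \<in> S \<Longrightarrow> 0 \<le> e j \<and> e j \<le> e i"
  shows "prod e S \<le> prod e {0..<card S}"
  using assms
proof (induction "card S" arbitrary: S)
  case 0
  then show ?case by simp
next
  case (Suc k)
  have S: "S \<noteq> {}" using Suc.hyps(2) by auto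
  let ?m = "Max S"
  have m: "?m \<in> S" using S Suc.prems by simp
  have k: "card (S - {?m}) = k" using Suc.hyps(2) Suc.prems m by simp
  have "S \<subseteq> {0..?m}" using Suc.prems by auto
  then have "card S \<le> card {0..?m}" by (intro card_mono) auto
  then have km: "k \<le> ?m" using Suc.hyps(2) by simp
  have "prod e S = e ?m * prod e (S - {?m})" using m Suc.prems by (intro prod.remove) auto
  also have "\<dots> \<le> e k * prod e {0..<k}"
  proof (rule mult_mono)
    show "prod e (S - {?m}) \<le> prod e {0..<k}"
      using Suc.hyps(1)[of "S - {?m}"] k Suc.prems by auto
  qed (use Suc.prems m km in \<open>force intro!: prod_nonneg\<close>)+
  finally show ?case by (simp flip: Suc.hyps(2) add: mult.commute)
qed

text \<open>Triangle inequality in the expansion \<open>det_weighted_gram\<close>, whose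
  coefficients are nonnegative and do not involve \<open>d\<close>.\<close>

lemma cmod_det_weighted_gram_le:
  fixes X :: "nat \<Rightarrow> nat \<Rightarrow> complex"
  shows "cmod (det (mat k k (\<lambda>(i,j). \<Sum>a = 0..<n. cnj (X a i) * d a * X a j)))
    \<le> cmod (det (mat k k (\<lambda>(i,j). \<Sum>a = 0..<n. cnj (X a i) * of_real (cmod (d a)) * X a j)))"
    (is "cmod ?L \<le> cmod ?R")
proof -
  let ?h = "\<lambda>f. (cmod (det (mat k k (\<lambda>(i,j). X (f i) j))))\<^sup>2"
  let ?F = "{0..<k} \<rightarrow>\<^sub>E {0..<n}"
  have "fact k * cmod ?L = cmod (fact k * ?L)" by (simp add: norm_mult)
  also have "\<dots> \<le> (\<Sum>f\<in>?F. (\<Prod>i = 0..<k. cmod (d (f i))) * ?h f)"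
    unfolding det_weighted_gram by (rule order_trans[OF norm_sum]) (simp add: norm_mult prod_norm norm_power)
  \<comment> \<open>With the weights \<open>cmod (d a)\<close> the expansion is a nonnegative real
    and equals its own modulus, so nothing is lost on the right-hand side.\<close>
  also have "\<dots> = cmod (of_real (\<Sum>f\<in>?F. (\<Prod>i = 0..<k. cmod (d (f i))) * ?h f))"
    by (simp only: norm_of_real) (simp add: sum_nonneg prod_nonneg)
  also have "\<dots> = cmod (fact k * ?R)"
    unfolding det_weighted_gram by simp
  also have "\<dots> = fact k * cmod ?R" by (simp add: norm_mult)
  finally show ?thesis by simp
qed

text \<open>Termwise bound in the expansion: an injective \<open>f\<close> picks \<open>k\<close>
  distinct indices, so \<open>prod_le_prod_initial\<close> bounds its product of weights, and any
  other \<open>f\<close> repeats a row and contributes zero. The sum of the coefficients that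
  remains is the expansion with all weights 1.\<close>

lemma det_weighted_gram_le_prod:
  fixes X :: "nat \<Rightarrow> nat \<Rightarrow> complex" and e :: "nat \<Rightarrow> real"
  assumes e: "\<And>i j. i \<le> j \<Longrightarrow> j < n \<Longrightarrow> 0 \<le> e j \<and> e j \<le> e i"
  shows "cmod (det (mat k k (\<lambda>(i,j). \<Sum>a = 0..<n. cnj (X a i) * of_real (e a) * X a j)))
    \<le> (\<Prod>i = 0..<k. e i) * cmod (det (mat k k (\<lambda>(i,j). \<Sum>a = 0..<n. cnj (X a i) * X a j)))"
    (is "cmod ?L \<le> ?p * cmod ?R")
proof -
  let ?h = "\<lambda>f. (cmod (det (mat k k (\<lambda>(i,j). X (f i) j))))\<^sup>2"
  let ?F = "{0..<k} \<rightarrow>\<^sub>E {0..<n}"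
  have e0: "0 \<le> e j" if "j < n" for j using e[of j j] that by simp
  have le: "(\<Prod>i = 0..<k. e (f i)) * ?h f \<le> ?p * ?h f" if f: "f \<in> ?F" for f
  proof (cases "inj_on f {0..<k}")
    case True
    have "(\<Prod>i = 0..<k. e (f i)) = prod e (f ` {0..<k})"
      using True by (simp add: prod.reindex)
    also have "\<dots> \<le> prod e {0..<card (f ` {0..<k})}"
      using f by (intro prod_le_prod_initial) (use e in \<open>fastforce simp: PiE_iff\<close>)+
    also have "\<dots> = ?p" using True by (simp add: card_image)
    finally show ?thesis by (intro mult_right_mono) auto
  next
    case False
    then obtain i j where ij: "i < k" "j < k" "i \<noteq> j" "f i = f j" by (auto simp: inj_on_def)
    have "det (mat k k (\<lambda>(i,j). X (f i) j)) = 0"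
      by (rule det_identical_rows[OF _ ij(3,1,2)]) (use ij in auto)
    then show ?thesis by simp
  qed
  have "fact k * ?R = of_real (\<Sum>f\<in>?F. ?h f)"
    using det_weighted_gram[where d = "\<lambda>_. 1" and k = k and n = n and X = X] by simp
  moreover have "fact k * cmod ?R = cmod (fact k * ?R)" by (simp add: norm_mult)
  ultimately have R: "fact k * cmod ?R = (\<Sum>f\<in>?F. ?h f)"
    by (simp only: norm_of_real) (simp add: sum_nonneg)
  have "fact k * cmod ?L = cmod (fact k * ?L)" by (simp add: norm_mult)
  also have "\<dots> = cmod (of_real (\<Sum>f\<in>?F. (\<Prod>i = 0..<k. e (f i)) * ?h f))"
    unfolding det_weighted_gram by simp
  also have "\<dots> = (\<Sum>f\<in>?F. (\<Prod>i = 0..<k. e (f i)) * ?h f)"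
    by (simp only: norm_of_real)
      (use e0 in \<open>auto simp: PiE_iff intro!: sum_nonneg prod_nonneg abs_of_nonneg mult_nonneg_nonneg\<close>)
  also have "\<dots> \<le> (\<Sum>f\<in>?F. ?p * ?h f)" by (intro sum_mono le)
  also have "\<dots> = fact k * (?p * cmod ?R)" using R by (simp add: sum_distrib_left[symmetric])
  finally show ?thesis by simp
qed

section \<open>Adjoints and unitary triangularisation\<close>

lemma dim_mat_adjoint [simp]:
  "dim_row (mat_adjoint A) = dim_col A" "dim_col (mat_adjoint A) = dim_row A"
  by (simp_all add: mat_adjoint_def)

lemma mat_adjoint_carrier [simp]: "A \<in> carrier_mat n m \<Longrightarrow> mat_adjoint A \<in> carrier_mat m n"
  by (intro carrier_matI) auto

lemma index_mat_adjoint [simp]: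
  "i < dim_col A \<Longrightarrow> j < dim_row A \<Longrightarrow> mat_adjoint A $$ (i, j) = conjugate (A $$ (j, i))"
  by (simp add: mat_adjoint_def mat_of_rows_index)

lemma mat_adjoint_mult:
  fixes A :: "complex mat"
  assumes "A \<in> carrier_mat n m" "B \<in> carrier_mat m p"
  shows "mat_adjoint (A * B) = mat_adjoint B * mat_adjoint A"
  using assms by (intro eq_matI) (auto simp: scalar_prod_def cnj_sum mult.commute intro!: sum.cong)

lemma mat_adjoint_adjoint [simp]: "mat_adjoint (mat_adjoint (A :: complex mat)) = A"
  by (intro eq_matI) auto

lemma mat_adjoint_one [simp]: "mat_adjoint (1\<^sub>m n) = (1\<^sub>m n :: complex mat)"
  by (intro eq_matI) auto

text \<open>Complete \<open>v\<close> to a basis, orthogonalise by Gram--Schmidt, which keeps the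
  first vector, and normalise the columns. The scalar \<open>c\<close> is the reciprocal of the norm
  of \<open>v\<close>.\<close>

lemma exists_unitary_first_col:
  fixes v :: "complex vec"
  assumes v: "v \<in> carrier_vec n" "v \<noteq> 0\<^sub>v n"
  obtains W c where "W \<in> carrier_mat n n" "mat_adjoint W * W = 1\<^sub>m n" "col W 0 = c \<cdot>\<^sub>v v"
proof -
  interpret cof_vec_space n "TYPE(complex)" .
  define b where "b = basis_completion v"
  define ws where "ws = gram_schmidt n b"
  note b = basis_completion[OF v, folded b_def]
  have n: "0 < n" using v by (cases n) auto
  then have "b \<noteq> []" using b(6) by auto
  then obtain vs where bv: "b = v # vs" using b(7) by (metis list.collapse)
  note gs = gram_schmidt_result[OF b(2,4,5) ws_def]
  have hd: "hd ws = v" using gram_schmidt_hd[OF v(1)] by (simp add: ws_def bv)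
  have len: "length ws = n" using gs(4) b(6,7) v(1) by simp
  have ws0: "ws ! 0 = v" using hd n len by (metis hd_conv_nth length_0_conv less_numeral_extra(3))
  have wsc: "ws ! i \<in> carrier_vec n" if "i < n" for i
    using gs(3) len that by auto
  define r where "r i = Re (ws ! i \<bullet>c ws ! i)" for i
  have sq: "ws ! i \<bullet>c ws ! i = of_real (r i)" "0 < r i" if i: "i < n" for i
  proof -
    have eq: "ws ! i \<bullet>c ws ! i = of_real (\<Sum>a = 0..<n. (cmod (ws ! i $ a))\<^sup>2)"
      using wsc[OF i] by (simp add: scalar_prod_def complex_norm_square[symmetric] del: of_real_power)
    then show 1: "ws ! i \<bullet>c ws ! i = of_real (r i)" by (simp add: r_def)
    have "ws ! i \<bullet>c ws ! i \<noteq> 0"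
      using corthogonalD[OF gs(2)] i len by auto
    moreover have "0 \<le> r i" by (simp add: r_def eq sum_nonneg)
    ultimately show "0 < r i" using 1 by (metis less_eq_real_def of_real_0)
  qed
  define W where "W = mat n n (\<lambda>(i, j). ws ! j $ i / of_real (sqrt (r j)))"
  have W: "W \<in> carrier_mat n n" by (simp add: W_def)
  have "mat_adjoint W * W = 1\<^sub>m n"
  proof (intro eq_matI)
    fix i j assume "i < dim_row (1\<^sub>m n :: complex mat)" "j < dim_col (1\<^sub>m n :: complex mat)"
    then have ij: "i < n" "j < n" by auto
    have "(mat_adjoint W * W) $$ (i, j) =
        (ws ! j \<bullet>c ws ! i) / (of_real (sqrt (r i)) * of_real (sqrt (r j)))"
      using ij wsc[of i] wsc[of j]
      by (simp add: W_def scalar_prod_def sum_divide_distrib mult.commute)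
    also have "\<dots> = 1\<^sub>m n $$ (i, j)"
    proof (cases "i = j")
      case True
      have "complex_of_real (sqrt (r i)) * of_real (sqrt (r i)) = of_real (r i)"
        using sq(2)[OF ij(1)] by (simp flip: of_real_mult)
      then show ?thesis using sq[OF ij(1)] ij True by simp
    next
      case False
      then have "ws ! j \<bullet>c ws ! i = 0" using corthogonalD[OF gs(2), of j i] ij len by simp
      then show ?thesis using False ij by simp
    qed
    finally show "(mat_adjoint W * W) $$ (i, j) = 1\<^sub>m n $$ (i, j)" .
  qed (simp_all add: W_def)
  moreover have "col W 0 = (1 / of_real (sqrt (r 0))) \<cdot>\<^sub>v v"
    using n v ws0 by (intro eq_vecI) (auto simp: W_def)
  ultimately show thesis using that W by blast
qed

lemma unitary_right_inverse:
  fixes U :: "complex mat"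
  assumes "U \<in> carrier_mat n n" "mat_adjoint U * U = 1\<^sub>m n"
  shows "U * mat_adjoint U = 1\<^sub>m n"
  using mat_mult_left_right_inverse[OF mat_adjoint_carrier[OF assms(1)] assms] .

lemma mat_adjoint_four_block:
  fixes A :: "complex mat"
  assumes "A \<in> carrier_mat n n" "D \<in> carrier_mat m m"
  shows "mat_adjoint (four_block_mat A (0\<^sub>m n m) (0\<^sub>m m n) D) =
    four_block_mat (mat_adjoint A) (0\<^sub>m n m) (0\<^sub>m m n) (mat_adjoint D)"
  using assms by (intro eq_matI) auto

text \<open>Deflation: a unitary matrix whose first column is an eigenvector for the head of
  \<open>es\<close> isolates that eigenvalue in the corner, and the induction hypothesis treats the
  trailing block. Recursion along \<open>es\<close> fixes the order on the diagonal, so that leading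
  blocks carry chosen eigenvalues.\<close>

lemma unitary_schur_decomposition:
  fixes A :: "complex mat"
  assumes "A \<in> carrier_mat n n" and "char_poly A = (\<Prod>e\<leftarrow>es. [:- e, 1:])"
  shows "\<exists>U \<in> carrier_mat n n. mat_adjoint U * U = 1\<^sub>m n \<and>
    upper_triangular (mat_adjoint U * A * U) \<and> diag_mat (mat_adjoint U * A * U) = es"
  using assms
proof (induction es arbitrary: n A)
  case Nil
  then have "n = 0" using degree_monic_char_poly[of A n] by simp
  then show ?case using Nil by (intro bexI[of _ "1\<^sub>m 0"]) (auto simp: diag_mat_def)
next
  case (Cons e es n A)
  note A = Cons.prems(1)
  have e: "eigenvalue A e"
    using Cons.prems(2) unfolding eigenvalue_root_char_poly[OF A] by simp
  then obtain v where v: "v \<in> carrier_vec n" "v \<noteq> 0\<^sub>v n" "A *\<^sub>v v = e \<cdot>\<^sub>v v"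
    using A unfolding eigenvalue_def eigenvector_def by auto
  obtain m where n: "n = Suc m" using v by (cases n) auto
  obtain W c where W: "W \<in> carrier_mat n n" "mat_adjoint W * W = 1\<^sub>m n" "col W 0 = c \<cdot>\<^sub>v v"
    using exists_unitary_first_col[OF v(1,2)] .
  let ?W = "mat_adjoint W"
  have W': "?W \<in> carrier_mat n n" using W(1) by simp
  define T where "T = ?W * A * W"
  have T: "T \<in> carrier_mat n n" using A W' W(1) by (auto simp: T_def intro!: mult_carrier_mat[of _ n n])
  \<comment> \<open>The first column of \<open>W\<close> is a multiple of the eigenvector
    \<open>v\<close>, so the first column of \<open>T\<close> is \<open>e\<close> times that of
    \<open>?W * W\<close>, which is the identity.\<close>
  have col0: "T $$ (i, 0) = (if i = 0 then e else 0)" if i: "i < n" for i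
  proof -
    have "T $$ (i, 0) = (?W * (A * W)) $$ (i, 0)"
      unfolding T_def using assoc_mult_mat[OF W' A W(1)] by simp
    also have "\<dots> = row ?W i \<bullet> col (A * W) 0"
      using W' A W(1) i n by (intro index_mult_mat) auto
    also have "col (A * W) 0 = A *\<^sub>v col W 0"
      using col_mult2[OF A W(1)] n by simp
    also have "A *\<^sub>v col W 0 = e \<cdot>\<^sub>v col W 0"
      using v A by (simp add: W(3) mult_mat_vec smult_smult_assoc mult.commute)
    also have "row ?W i \<bullet> (e \<cdot>\<^sub>v col W 0) = e * (?W * W) $$ (i, 0)"
      using W' W(1) i n by simp
    finally show ?thesis using i n by (simp add: W(2))
  qed
  define A1 where "A1 = mat 1 1 (\<lambda>_. e)"
  define A2 where "A2 = mat 1 m (\<lambda>(i, j). T $$ (0, Suc j))"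
  define A3 where "A3 = mat m m (\<lambda>(i, j). T $$ (Suc i, Suc j))"
  have A123: "A1 \<in> carrier_mat 1 1" "A2 \<in> carrier_mat 1 m" "A3 \<in> carrier_mat m m"
    by (auto simp: A1_def A2_def A3_def)
  have Tb: "T = four_block_mat A1 A2 (0\<^sub>m m 1) A3"
    using T n col0 by (intro eq_matI) (auto simp: A1_def A2_def A3_def)
  \<comment> \<open>Similarity preserves the characteristic polynomial, which is multiplicative over
    the diagonal blocks. Cancelling the factor for \<open>e\<close> leaves exactly \<open>es\<close>
    for \<open>A3\<close>, as the induction hypothesis requires.\<close>
  have "similar_mat T A"
    unfolding similar_mat_def
    using similar_mat_witI[OF W(2) unitary_right_inverse[OF W(1,2)] T_def T A W' W(1)] by blast
  then have "char_poly A1 * char_poly A3 = [:- e, 1:] * (\<Prod>e\<leftarrow>es. [:- e, 1:])"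
    using char_poly_similar[of T A] Cons.prems(2) char_poly_four_block_zeros_col[OF A123] Tb by simp
  moreover have "char_poly A1 = [:- e, 1:]"
    by (simp add: A1_def char_poly_defs det_def sign_def)
  ultimately have "char_poly A3 = (\<Prod>e\<leftarrow>es. [:- e, 1:])"
    by (metis mult_cancel_left pCons_eq_0_iff zero_neq_one)
  from Cons.IH[OF A123(3) this] obtain V where
    V: "V \<in> carrier_mat m m" "mat_adjoint V * V = 1\<^sub>m m"
      "upper_triangular (mat_adjoint V * A3 * V)" "diag_mat (mat_adjoint V * A3 * V) = es"
    by blast
  let ?V = "mat_adjoint V"
  have V': "?V \<in> carrier_mat m m" using V(1) by simp
  \<comment> \<open>\<open>F\<close> applies \<open>V\<close> to the trailing block and fixes the
    corner; the unitary matrix sought is \<open>W * F\<close>.\<close>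
  define F where "F = four_block_mat (1\<^sub>m 1) (0\<^sub>m 1 m) (0\<^sub>m m 1) V"
  let ?F = "mat_adjoint F"
  have F: "F \<in> carrier_mat n n" using V(1) n by (auto simp: F_def)
  have F': "?F = four_block_mat (1\<^sub>m 1) (0\<^sub>m 1 m) (0\<^sub>m m 1) ?V"
    using mat_adjoint_four_block[of "1\<^sub>m 1" 1 V m] V(1) by (simp add: F_def)
  have Fc: "?F \<in> carrier_mat n n" using F by simp
  have FF: "?F * F = 1\<^sub>m n"
    unfolding F' unfolding F_def n using V(1,2) V'
    by (subst mult_four_block_mat[of _ 1 1 _ m _ m _ _ 1 _ m]) auto
  have VA: "?V * A3 \<in> carrier_mat m m" using V' A123(3) by (rule mult_carrier_mat)
  have FT: "?F * T = four_block_mat A1 A2 (0\<^sub>m m 1) (?V * A3)"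
    unfolding F' Tb using A123 V' VA right_mult_zero_mat[OF V']
    by (subst mult_four_block_mat[of _ 1 1 _ m _ m _ _ 1 _ m]) auto
  have FTF: "?F * T * F = four_block_mat A1 (A2 * V) (0\<^sub>m m 1) (?V * A3 * V)"
    unfolding FT unfolding F_def
    using A123 V(1) VA right_mult_zero_mat[OF VA] right_mult_zero_mat[OF A123(1)] right_mult_zero_mat[OF A123(2)]
      mult_carrier_mat[OF VA V(1)] mult_carrier_mat[OF A123(2) V(1)]
    by (subst mult_four_block_mat[of _ 1 1 _ m _ m _ _ 1 _ m]) auto
  have adjU: "mat_adjoint (W * F) = ?F * ?W" using W(1) F by (rule mat_adjoint_mult)
  have "?F * ?W * (W * F) = ?F * (?W * W) * F"
    using assoc_mult_mat[OF mult_carrier_mat[OF Fc W'] W(1) F] assoc_mult_mat[OF Fc W' W(1)] by simp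
  then have UU: "mat_adjoint (W * F) * (W * F) = 1\<^sub>m n"
    using adjU W(2) FF right_mult_one_mat[OF Fc] by simp
  have "?F * ?W * A * (W * F) = ?F * T * F"
    unfolding T_def
    using assoc_mult_mat[OF mult_carrier_mat[OF mult_carrier_mat[OF Fc W'] A] W(1) F]
      assoc_mult_mat[OF Fc W' A] assoc_mult_mat[OF Fc mult_carrier_mat[OF W' A] W(1)] by simp
  then have UAU: "mat_adjoint (W * F) * A * (W * F) = four_block_mat A1 (A2 * V) (0\<^sub>m m 1) (?V * A3 * V)"
    using adjU FTF by simp
  have A3c: "?V * A3 * V \<in> carrier_mat m m"
    using VA V(1) by (rule mult_carrier_mat)
  have "upper_triangular (mat_adjoint (W * F) * A * (W * F))"
    unfolding UAU by (rule upper_triangular_four_block[OF A123(1) A3c _ V(3)]) (auto simp: A1_def)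
  moreover have "diag_mat (mat_adjoint (W * F) * A * (W * F)) = e # es"
    unfolding UAU diag_four_block_mat[OF A123(1) A3c] V(4) by (simp add: A1_def diag_mat_def)
  ultimately show ?case using UU W(1) F by (intro bexI[of _ "W * F"]) auto
qed

section \<open>Eigenvalue products of compressed diagonal matrices\<close>

text \<open>Translates matrix products into the explicit sums of
  \<open>det_weighted_gram\<close>.\<close>

lemma adjoint_conj_mat_diag_index:
  fixes Z :: "complex mat"
  assumes "Z \<in> carrier_mat n n" "i < n" "j < n"
  shows "(mat_adjoint Z * mat_diag n d * Z) $$ (i, j) = (\<Sum>a = 0..<n. cnj (Z $$ (a, i)) * d a * Z $$ (a, j))"
  using assms by (simp add: mat_diag_mult_right[of _ n n] scalar_prod_def)

lemma det_leading_block_upper_triangular: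
  assumes "T \<in> carrier_mat n n" "upper_triangular T" "k \<le> n"
  shows "det (mat k k (\<lambda>(i, j). T $$ (i, j))) = (\<Prod>i = 0..<k. T $$ (i, i))"
proof -
  have "det (mat k k (\<lambda>(i, j). T $$ (i, j))) = prod_list (diag_mat (mat k k (\<lambda>(i, j). T $$ (i, j))))"
    by (rule det_upper_triangular[of _ k]) (use assms in \<open>auto simp: upper_triangular_def\<close>)
  also have "\<dots> = (\<Prod>i = 0..<k. T $$ (i, i))"
    unfolding prod_list_diag_prod by (auto intro: prod.cong)
  finally show ?thesis .
qed

text \<open>Both Gram bounds meet in one determinant: the leading minor of \<open>Z* |D| Z\<close>
  with \<open>Z = P * U\<close> dominates the triangular minor that carries the \<open>l i\<close>,
  and it is also a weighted Gram determinant of the unitary \<open>Y\<close> with the weights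
  \<open>e\<close>.\<close>

lemma prod_eigenvalues_compression_le:
  fixes P :: "complex mat" and e :: "nat \<Rightarrow> real"
  assumes P: "P \<in> carrier_mat n n" "mat_adjoint P = P"
    and l: "char_poly (P * mat_diag n d * P) = (\<Prod>a\<leftarrow>map l [0..<n]. [:- a, 1:])"
    and e: "char_poly (P * mat_diag n (\<lambda>i. of_real (cmod (d i))) * P) =
        (\<Prod>a\<leftarrow>map (\<lambda>i. of_real (e i)) [0..<n]. [:- a, 1:])"
    and dec: "\<And>i j. i \<le> j \<Longrightarrow> j < n \<Longrightarrow> 0 \<le> e j \<and> e j \<le> e i"
    and k: "k \<le> n"
  shows "(\<Prod>i = 0..<k. cmod (l i)) \<le> (\<Prod>i = 0..<k. e i)"
proof -
  let ?d = "\<lambda>i. complex_of_real (cmod (d i))"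
  let ?e = "\<lambda>i. complex_of_real (e i)"
  define M where "M = P * mat_diag n d * P"
  define N where "N = P * mat_diag n ?d * P"
  have MN: "M \<in> carrier_mat n n" "N \<in> carrier_mat n n"
    using P by (auto simp: M_def N_def intro!: mult_carrier_mat[of _ n n])
  obtain U where U: "U \<in> carrier_mat n n" "mat_adjoint U * U = 1\<^sub>m n"
      "upper_triangular (mat_adjoint U * M * U)" "diag_mat (mat_adjoint U * M * U) = map l [0..<n]"
    using unitary_schur_decomposition[OF MN(1) l[folded M_def]] by blast
  obtain V where V: "V \<in> carrier_mat n n" "mat_adjoint V * V = 1\<^sub>m n"
      "upper_triangular (mat_adjoint V * N * V)" "diag_mat (mat_adjoint V * N * V) = map ?e [0..<n]"
    using unitary_schur_decomposition[OF MN(2) e[folded N_def]] by blast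
  have U': "mat_adjoint U \<in> carrier_mat n n" and V': "mat_adjoint V \<in> carrier_mat n n"
    using U V by auto
  have diag_nth: "A $$ (i, i) = xs i" if "diag_mat A = map xs [0..<n]" "A \<in> carrier_mat n n" "i < n"
    for A :: "complex mat" and xs i
    using arg_cong[OF that(1), of "\<lambda>ys. ys ! i"] that by (simp add: diag_mat_def)

  define Z where "Z = P * U"
  have Z: "Z \<in> carrier_mat n n" using P U by (simp add: Z_def)
  have ZZ: "mat_adjoint Z * mat_diag n f * Z = mat_adjoint U * (P * mat_diag n f * P) * U" for f
  proof -
    have "mat_adjoint Z = mat_adjoint U * P"
      unfolding Z_def using mat_adjoint_mult[OF P(1) U(1)] P(2) by simp
    then show ?thesis
      using P U(1) U' mat_diag_dim[of n f] unfolding Z_def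
      by (smt (verit) assoc_mult_mat mult_carrier_mat)
  qed
  define T where "T = mat_adjoint U * M * U"
  have T: "T \<in> carrier_mat n n" using U' U(1) MN by (auto simp: T_def intro!: mult_carrier_mat[of _ n n])
  \<comment> \<open>The Gram matrix with the weights \<open>d\<close> is the leading block of the
    triangular \<open>T\<close>, so its determinant is the product of the first \<open>k\<close>
    values of \<open>l\<close>.\<close>
  have "mat k k (\<lambda>(i, j). \<Sum>a = 0..<n. cnj (Z $$ (a, i)) * d a * Z $$ (a, j)) =
      mat k k (\<lambda>(i, j). T $$ (i, j))"
    using k by (intro eq_matI)
      (auto simp: T_def M_def ZZ[symmetric] adjoint_conj_mat_diag_index[OF Z] simp del: index_mult_mat)
  then have 1: "cmod (det (mat k k (\<lambda>(i, j). \<Sum>a = 0..<n. cnj (Z $$ (a, i)) * d a * Z $$ (a, j)))) =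
      (\<Prod>i = 0..<k. cmod (l i))"
    using det_leading_block_upper_triangular[OF T _ k] U(3) diag_nth[OF U(4)] T k
    by (simp add: T_def[symmetric] prod_norm[symmetric])

  define S where "S = mat_adjoint V * N * V"
  have S: "S \<in> carrier_mat n n" using V' V(1) MN by (auto simp: S_def intro!: mult_carrier_mat[of _ n n])
  have adjN: "mat_adjoint N = N"
  proof -
    have "mat_adjoint (mat_diag n ?d) = mat_diag n ?d"
      by (intro eq_matI) (auto simp: mat_diag_def)
    then have "mat_adjoint N = P * (mat_diag n ?d * P)"
      using P(2) unfolding N_def
      by (simp add: mat_adjoint_mult[OF mult_carrier_mat[OF P(1) mat_diag_dim] P(1)]
          mat_adjoint_mult[OF P(1) mat_diag_dim])
    then show ?thesis
      unfolding N_def using assoc_mult_mat[OF P(1) mat_diag_dim P(1)] by simp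
  qed
  have "mat_adjoint S = mat_adjoint V * (N * V)"
    unfolding S_def mat_adjoint_mult[OF mult_carrier_mat[OF V' MN(2)] V(1)]
      mat_adjoint_mult[OF V' MN(2)] adjN by simp
  then have adjS: "mat_adjoint S = S"
    unfolding S_def using assoc_mult_mat[OF V' MN(2) V(1)] by simp
  \<comment> \<open>A matrix that is both Hermitian and upper triangular is diagonal, so the Schur
    form of \<open>N\<close> diagonalises it.\<close>
  have Sd: "S = mat_diag n ?e"
  proof (intro eq_matI)
    fix i j assume "i < dim_row (mat_diag n ?e)" "j < dim_col (mat_diag n ?e)"
    then have ij: "i < n" "j < n" by (auto simp: mat_diag_def)
    have low: "S $$ (i, j) = 0" if "j < i" "i < n" for i j
      using V(3) S that by (auto simp: S_def[symmetric])
    consider "i = j" | "j < i" | "i < j" by linarith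
    then show "S $$ (i, j) = mat_diag n ?e $$ (i, j)"
    proof cases
      case 1
      then show ?thesis using ij diag_nth[OF V(4)] S by (simp add: S_def[symmetric] mat_diag_def)
    next
      case 2
      then show ?thesis using ij low by (simp add: mat_diag_def)
    next
      case 3
      have "S $$ (i, j) = mat_adjoint S $$ (i, j)" by (simp add: adjS)
      also have "\<dots> = 0" using ij 3 low S by simp
      finally show ?thesis using ij 3 by (simp add: mat_diag_def)
    qed
  qed (use S in \<open>auto simp: mat_diag_def\<close>)
  \<comment> \<open>The columns of \<open>Y\<close> are those of \<open>U\<close> in coordinates of
    the eigenbasis \<open>V\<close> of \<open>N\<close>.\<close>
  define Y where "Y = mat_adjoint V * U"
  have Y: "Y \<in> carrier_mat n n" using U V' by (simp add: Y_def)
  have adjY: "mat_adjoint Y = mat_adjoint U * V"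
    unfolding Y_def using mat_adjoint_mult[OF V' U(1)] by simp
  have VV: "V * mat_adjoint V = 1\<^sub>m n" using unitary_right_inverse V by blast
  have YY: "mat_adjoint Y * Y = 1\<^sub>m n"
  proof -
    have "mat_adjoint Y * Y = mat_adjoint U * (V * mat_adjoint V) * U"
      unfolding adjY unfolding Y_def using U(1) U' V(1) V' by (smt (verit) assoc_mult_mat mult_carrier_mat)
    then show ?thesis using VV U U' by simp
  qed
  have YSY: "mat_adjoint Y * mat_diag n ?e * Y = mat_adjoint U * N * U"
  proof -
    have "mat_adjoint Y * S * Y = mat_adjoint U * ((V * mat_adjoint V) * N * (V * mat_adjoint V)) * U"
      unfolding adjY unfolding Y_def S_def using U(1) U' V(1) V' MN(2)
      by (smt (verit) assoc_mult_mat mult_carrier_mat)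
    then show ?thesis using VV MN(2) by (simp add: Sd)
  qed
  have 2: "mat k k (\<lambda>(i, j). \<Sum>a = 0..<n. cnj (Z $$ (a, i)) * ?d a * Z $$ (a, j)) =
      mat k k (\<lambda>(i, j). \<Sum>a = 0..<n. cnj (Y $$ (a, i)) * ?e a * Y $$ (a, j))"
  proof -
    have "(\<Sum>a = 0..<n. cnj (Z $$ (a, i)) * ?d a * Z $$ (a, j)) =
        (\<Sum>a = 0..<n. cnj (Y $$ (a, i)) * ?e a * Y $$ (a, j))" if ij: "i < n" "j < n" for i j
    proof -
      have "(\<Sum>a = 0..<n. cnj (Z $$ (a, i)) * ?d a * Z $$ (a, j)) =
          (mat_adjoint Z * mat_diag n ?d * Z) $$ (i, j)"
        by (rule adjoint_conj_mat_diag_index[OF Z ij, symmetric])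
      also have "mat_adjoint Z * mat_diag n ?d * Z = mat_adjoint U * N * U"
        unfolding N_def by (rule ZZ)
      also have "\<dots> = mat_adjoint Y * mat_diag n ?e * Y"
        by (rule YSY[symmetric])
      also have "\<dots> $$ (i, j) = (\<Sum>a = 0..<n. cnj (Y $$ (a, i)) * ?e a * Y $$ (a, j))"
        by (rule adjoint_conj_mat_diag_index[OF Y ij])
      finally show ?thesis .
    qed
    then show ?thesis using k by (intro eq_matI) auto
  qed
  \<comment> \<open>The first \<open>k\<close> columns of \<open>Y\<close> are orthonormal, so the
    unweighted Gram determinant in \<open>det_weighted_gram_le_prod\<close> equals 1.\<close>
  have 3: "mat k k (\<lambda>(i, j). \<Sum>a = 0..<n. cnj (Y $$ (a, i)) * Y $$ (a, j)) = 1\<^sub>m k"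
  proof (intro eq_matI)
    fix i j assume "i < dim_row (1\<^sub>m k :: complex mat)" "j < dim_col (1\<^sub>m k :: complex mat)"
    then have ij: "i < k" "j < k" by auto
    have "(\<Sum>a = 0..<n. cnj (Y $$ (a, i)) * Y $$ (a, j)) = (mat_adjoint Y * Y) $$ (i, j)"
      using Y ij k by (simp add: scalar_prod_def)
    then show "mat k k (\<lambda>(i, j). \<Sum>a = 0..<n. cnj (Y $$ (a, i)) * Y $$ (a, j)) $$ (i, j) = 1\<^sub>m k $$ (i, j)"
      using ij k by (simp add: YY)
  qed auto
  show ?thesis
    using cmod_det_weighted_gram_le[where k = k and n = n and X = "\<lambda>a i. Z $$ (a, i)" and d = d]
      det_weighted_gram_le_prod[where k = k and n = n and X = "\<lambda>a i. Y $$ (a, i)" and e = e] dec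
    unfolding 1 2 3 by simp
qed

section \<open>Determinants of commuted products and rank-one perturbations\<close>

text \<open>
  Both sides are read off from
  \<open>[x - AB, 0; - B, x] * [1, A; 0, 1] = [1, A; 0, 1] * [x, 0; - B, x - BA]\<close>.
\<close>
lemma det_smult_one_minus_mult_commute:
  fixes A :: "'a :: idom mat"
  assumes A: "A \<in> carrier_mat n n" and B: "B \<in> carrier_mat n n" and x: "x \<noteq> 0"
  shows "det (x \<cdot>\<^sub>m 1\<^sub>m n - A * B) = det (x \<cdot>\<^sub>m 1\<^sub>m n - B * A)"
proof -
  let ?x = "x \<cdot>\<^sub>m 1\<^sub>m n :: 'a mat"
  let ?O = "0\<^sub>m n n :: 'a mat" and ?I = "1\<^sub>m n :: 'a mat"
  have c: "A * B \<in> carrier_mat n n" "B * A \<in> carrier_mat n n" "?x \<in> carrier_mat n n"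
    "- B \<in> carrier_mat n n" "?I \<in> carrier_mat n n" "?O \<in> carrier_mat n n"
    "?x - A * B \<in> carrier_mat n n" "?x - B * A \<in> carrier_mat n n"
    using A B by auto
  have xm: "?x * C = x \<cdot>\<^sub>m C" "C * ?x = x \<cdot>\<^sub>m C" if "C \<in> carrier_mat n n" for C
    using that by (auto simp: mult_smult_distrib[of _ n n _ n] mult_smult_assoc_mat[of _ n n _ n])
  let ?L = "four_block_mat (?x - A * B) ?O (- B) ?x"
  let ?R = "four_block_mat ?x ?O (- B) (?x - B * A)"
  let ?T = "four_block_mat ?I A ?O ?I"
  have ABA: "A * B * A = A * (B * A)" using A B by (simp add: assoc_mult_mat[of _ n n _ n _ n])
  have "(?x - A * B) * A = A * (?x - B * A)"
    using A B c by (simp add: minus_mult_distrib_mat[of _ n n _ _ n] mult_minus_distrib_mat[of _ n n _ n] xm ABA)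
  moreover have "?x - A * B = ?x + A * (- B)"
    using A B by (intro eq_matI) (auto simp: uminus_mult_right_mat)
  moreover have "- B * A + ?x = ?x - B * A"
    using A B by (intro eq_matI) (auto simp: uminus_mult_left_mat)
  ultimately have "?L * ?T = ?T * ?R"
    using A B c
    by (simp add: mult_four_block_mat[of _ n n _ n _ n _ _ n _ n])
  then have "det ?L * det ?T = det ?T * det ?R"
    using c A by (metis det_mult four_block_carrier_mat)
  moreover have "det ?T = 1"
    using det_four_block_mat_lower_left_zero[OF c(5) A refl c(5)] by simp
  moreover have "det ?L = det (?x - A * B) * x ^ n"
    using det_four_block_mat_upper_right_zero[OF c(7) refl c(4) c(3)] by simp
  moreover have "det ?R = x ^ n * det (?x - B * A)"
    using det_four_block_mat_upper_right_zero[OF c(3) refl c(4) c(8)] by simp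
  \<comment> \<open>Both sides carry the factor \<open>x ^ n\<close>, which cancels because
    \<open>x\<close> is nonzero.\<close>
  ultimately show ?thesis using x by simp
qed

text \<open>The rank-one part is \<open>- A * B\<close>, where \<open>A\<close> is supported on its
  first column and \<open>B\<close> on its first row. After commuting, \<open>B * A\<close> has a
  single possibly nonzero entry, in the corner.\<close>

lemma det_one_plus_rank_one:
  fixes p q :: "nat \<Rightarrow> 'a :: idom"
  shows "det (mat n n (\<lambda>(i, j). of_bool (i = j) + p i * q j)) = 1 + (\<Sum>i = 0..<n. q i * p i)"
proof (cases n)
  case 0
  then show ?thesis by simp
next
  case (Suc m)
  define A where "A = mat n n (\<lambda>(i, j). if j = 0 then - p i else 0)"
  define B where "B = mat n n (\<lambda>(i, j). if i = 0 then q j else 0)"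
  have AB: "A \<in> carrier_mat n n" "B \<in> carrier_mat n n" by (auto simp: A_def B_def)
  have "mat n n (\<lambda>(i, j). of_bool (i = j) + p i * q j) = 1 \<cdot>\<^sub>m 1\<^sub>m n - A * B"
    using Suc by (intro eq_matI) (auto simp: A_def B_def scalar_prod_def sum.atLeast_Suc_lessThan)
  then have "det (mat n n (\<lambda>(i, j). of_bool (i = j) + p i * q j)) = det (1 \<cdot>\<^sub>m 1\<^sub>m n - B * A)"
    using det_smult_one_minus_mult_commute[OF AB, of 1] by simp
  also have "1 \<cdot>\<^sub>m 1\<^sub>m n - B * A =
      mat_diag n (\<lambda>i. if i = 0 then 1 + (\<Sum>i = 0..<n. q i * p i) else 1)"
    by (intro eq_matI) (auto simp: A_def B_def scalar_prod_def mat_diag_def sum_negf)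
  also have "det \<dots> = (\<Prod>i = 0..<n. if i = 0 then 1 + (\<Sum>i = 0..<n. q i * p i) else 1)"
    by (subst det_upper_triangular[of _ n]) (auto simp: mat_diag_def prod_list_diag_prod intro!: prod.cong)
  also have "\<dots> = 1 + (\<Sum>i = 0..<n. q i * p i)"
    using Suc by (subst prod.delta) auto
  finally show ?thesis .
qed

section \<open>Characteristic polynomial of the compression\<close>

lemma poly_char_poly_eq_det:
  fixes A :: "'a :: field mat"
  assumes "A \<in> carrier_mat n n"
  shows "poly (char_poly A) x = det (x \<cdot>\<^sub>m 1\<^sub>m n - A)"
  unfolding char_poly_matrix[OF assms]
  using assms by (intro arg_cong[of _ _ det] eq_matI) (auto simp: char_matrix_def)

text \<open>For a unit vector \<open>s\<close> this is \<open>I - s s^T\<close>, the orthogonal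
  projection onto the complement of \<open>s\<close>.\<close>

definition complement_proj :: "nat \<Rightarrow> (nat \<Rightarrow> real) \<Rightarrow> complex mat" where
  "complement_proj n s = mat n n (\<lambda>(i, j). of_bool (i = j) - of_real (s i * s j))"

lemma complement_proj_carrier [simp]: "complement_proj n s \<in> carrier_mat n n"
  by (simp add: complement_proj_def)

lemma complement_proj_idem:
  assumes "(\<Sum>i = 0..<n. (s i)\<^sup>2) = 1"
  shows "complement_proj n s * complement_proj n s = complement_proj n s"
proof (intro eq_matI)
  fix i j assume "i < dim_row (complement_proj n s)" "j < dim_col (complement_proj n s)"
  then have ij: "i < n" "j < n" by (auto simp: complement_proj_def)
  have "(\<Sum>a = 0..<n. (of_bool (i = a) - complex_of_real (s i * s a)) * (of_bool (a = j) - of_real (s a * s j))) =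
      of_real (\<Sum>a = 0..<n. (of_bool (i = a) - s i * s a) * (of_bool (a = j) - s a * s j))"
    unfolding of_real_sum by (intro sum.cong refl) (auto simp: of_bool_def)
  also have "(\<Sum>a = 0..<n. (of_bool (i = a) - s i * s a) * (of_bool (a = j) - s a * s j)) =
     (\<Sum>a = 0..<n. (if a = i then of_bool (i = j) - s i * s j else 0) - (if a = j then s i * s j else 0)
        + s i * s j * (s a)\<^sup>2)"
    by (intro sum.cong) (auto simp: algebra_simps power2_eq_square)
  also have "\<dots> = of_bool (i = j) - s i * s j"
    using ij assms by (simp add: sum.distrib sum_subtractf sum_distrib_left[symmetric])
  finally show "(complement_proj n s * complement_proj n s) $$ (i, j) = complement_proj n s $$ (i, j)"
    using ij by (simp add: complement_proj_def scalar_prod_def of_bool_def if_distrib[of complex_of_real])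
qed (auto simp: complement_proj_def)

text \<open>Commuting the factors and idempotence replace \<open>P D P\<close> by
  \<open>P D\<close>. Then \<open>x - P D = (x - D) + s s^T D\<close> is \<open>x - D\<close> times
  a rank-one perturbation of the identity.\<close>

lemma det_compression:
  assumes s: "(\<Sum>i = 0..<n. (s i)\<^sup>2) = 1" and x: "x \<noteq> 0" "\<And>i. i < n \<Longrightarrow> x \<noteq> d i"
  shows "det (x \<cdot>\<^sub>m 1\<^sub>m n - complement_proj n s * mat_diag n d * complement_proj n s) =
    x * ((\<Prod>i = 0..<n. x - d i) * (\<Sum>i = 0..<n. of_real ((s i)\<^sup>2) / (x - d i)))"
proof -
  let ?P = "complement_proj n s" and ?D = "mat_diag n d"
  let ?R = "mat n n (\<lambda>(i, j). of_bool (i = j) + (of_real (s i) / (x - d i)) * (of_real (s j) * d j))"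
  have PD: "?P * ?D \<in> carrier_mat n n" by (rule mult_carrier_mat[of _ n n]) auto
  have "det (x \<cdot>\<^sub>m 1\<^sub>m n - ?P * ?D * ?P) = det (x \<cdot>\<^sub>m 1\<^sub>m n - ?P * (?P * ?D))"
    using det_smult_one_minus_mult_commute[OF PD _ x(1), of ?P] by simp
  also have "?P * (?P * ?D) = ?P * ?D"
    using complement_proj_idem[OF s] assoc_mult_mat[of ?P n n ?P n ?D n] by simp
  also have "x \<cdot>\<^sub>m 1\<^sub>m n - ?P * ?D = mat_diag n (\<lambda>i. x - d i) * ?R"
  proof (intro eq_matI)
    fix i j
    assume "i < dim_row (mat_diag n (\<lambda>i. x - d i) * ?R)" "j < dim_col (mat_diag n (\<lambda>i. x - d i) * ?R)"
    then have ij: "i < n" "j < n" by (auto simp: mat_diag_def)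
    have L: "(?P * ?D) $$ (i, j) = (of_bool (i = j) - of_real (s i * s j)) * d j"
      unfolding mat_diag_mult_right[OF complement_proj_carrier]
      using ij by (simp add: complement_proj_def)
    have "(mat_diag n (\<lambda>i. x - d i) * ?R) $$ (i, j) =
        (x - d i) * (of_bool (i = j) + (of_real (s i) / (x - d i)) * (of_real (s j) * d j))"
      unfolding mat_diag_mult_left[of ?R n n, OF mat_carrier] using ij by simp
    also have "\<dots> = (x - d i) * of_bool (i = j) + of_real (s i) * (of_real (s j) * d j)"
      using x(2)[OF ij(1)] by (simp add: distrib_left)
    also have "\<dots> = x * of_bool (i = j) - (?P * ?D) $$ (i, j)"
      unfolding L by (cases "i = j") (auto simp: algebra_simps)
    also have "\<dots> = (x \<cdot>\<^sub>m 1\<^sub>m n - ?P * ?D) $$ (i, j)"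
      using ij PD
      by (simp add: of_bool_def carrier_matD[OF complement_proj_carrier] carrier_matD[OF mat_diag_dim]
          del: index_mult_mat(1))
    finally show "(x \<cdot>\<^sub>m 1\<^sub>m n - ?P * ?D) $$ (i, j) = (mat_diag n (\<lambda>i. x - d i) * ?R) $$ (i, j)"
      by (rule sym)
  qed (auto simp: mat_diag_def complement_proj_def)
  also have "det \<dots> = det (mat_diag n (\<lambda>i. x - d i)) * det ?R"
    by (rule det_mult) auto
  also have "det (mat_diag n (\<lambda>i. x - d i)) = (\<Prod>i = 0..<n. x - d i)"
    by (subst det_upper_triangular[of _ n]) (auto simp: mat_diag_def prod_list_diag_prod intro!: prod.cong)
  also have "det ?R = 1 + (\<Sum>i = 0..<n. of_real (s i) * d i * (of_real (s i) / (x - d i)))"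
    by (rule det_one_plus_rank_one)
  \<comment> \<open>Writing 1 as the sum of the squares of \<open>s\<close> merges it with the
    rank-one sum and brings out the factor \<open>x\<close>.\<close>
  also have "1 = (\<Sum>i = 0..<n. complex_of_real ((s i)\<^sup>2))"
    using s by (simp only: of_real_sum[symmetric] of_real_1)
  also have "(\<Sum>i = 0..<n. complex_of_real ((s i)\<^sup>2)) + (\<Sum>i = 0..<n. of_real (s i) * d i * (of_real (s i) / (x - d i)))
      = (\<Sum>i = 0..<n. x * (of_real ((s i)\<^sup>2) / (x - d i)))"
    unfolding sum.distrib[symmetric]
    using x(2) by (intro sum.cong) (auto simp: field_simps power2_eq_square)
  also have "\<dots> = x * (\<Sum>i = 0..<n. of_real ((s i)\<^sup>2) / (x - d i))"
    by (simp only: sum_distrib_left)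
  finally show ?thesis by (simp only: mult.left_commute)
qed

text \<open>Partial-fraction form away from the points \<open>z j\<close>, with indices shifted to
  start at 0 as for matrices.\<close>

lemma poly_incomplete_comb:
  assumes "\<And>i. i < n \<Longrightarrow> x \<noteq> z (Suc i)"
  shows "poly (incomplete_comb n \<gamma> z) x =
    (\<Prod>i = 0..<n. x - z (Suc i)) * (\<Sum>i = 0..<n. of_real (\<gamma> (Suc i)) / (x - z (Suc i)))"
proof -
  have nz: "x - z k \<noteq> 0" if "k \<in> {1..n}" for k
    using assms[of "k - 1"] that by (cases k) auto
  have "poly (incomplete_comb n \<gamma> z) x =
      (\<Sum>k = 1..n. of_real (\<gamma> k) * (\<Prod>j \<in> {1..n} - {k}. x - z j))"
    by (simp add: incomplete_comb_def poly_sum poly_prod)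
  also have "\<dots> = (\<Sum>k = 1..n. (\<Prod>j = 1..n. x - z j) * (of_real (\<gamma> k) / (x - z k)))"
  proof (intro sum.cong refl)
    fix k assume k: "k \<in> {1..n}"
    then have "(\<Prod>j = 1..n. x - z j) = (x - z k) * (\<Prod>j \<in> {1..n} - {k}. x - z j)"
      by (intro prod.remove) auto
    then show "of_real (\<gamma> k) * (\<Prod>j \<in> {1..n} - {k}. x - z j) =
        (\<Prod>j = 1..n. x - z j) * (of_real (\<gamma> k) / (x - z k))"
      using nz[OF k] by simp
  qed
  also have "\<dots> = (\<Prod>j = 1..n. x - z j) * (\<Sum>k = 1..n. of_real (\<gamma> k) / (x - z k))"
    by (simp add: sum_distrib_left)
  finally show ?thesis
    by (simp add: sum.atLeast1_atMost_eq prod.atLeast1_atMost_eq atLeast0LessThan)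
qed

text \<open>Both sides agree outside the finite set consisting of 0 and the \<open>z j\<close>,
  where the determinant formula and the partial fractions apply; polynomials that agree at
  infinitely many points are equal.\<close>

lemma char_poly_compression:
  assumes g0: "\<And>k. k \<in> {1..n} \<Longrightarrow> \<gamma> k \<ge> 0" and g1: "(\<Sum>k = 1..n. \<gamma> k) = 1"
  defines "P \<equiv> complement_proj n (\<lambda>i. sqrt (\<gamma> (Suc i)))"
  shows "char_poly (P * mat_diag n (\<lambda>i. z (Suc i)) * P) = [:0, 1:] * incomplete_comb n \<gamma> z"
    (is "?p = ?q")
proof (rule ccontr)
  assume "?p \<noteq> ?q"
  then have fin: "finite {x. poly (?p - ?q) x = 0}" by (intro poly_roots_finite) simp
  have sq: "(sqrt (\<gamma> (Suc i)))\<^sup>2 = \<gamma> (Suc i)" if "i < n" for i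
    using g0[of "Suc i"] that by simp
  have s: "(\<Sum>i = 0..<n. (sqrt (\<gamma> (Suc i)))\<^sup>2) = 1"
    using g1 sq by (simp add: sum.atLeast1_atMost_eq atLeast0LessThan)
  have "poly (?p - ?q) x = 0" if x: "x \<notin> insert 0 ((\<lambda>i. z (Suc i)) ` {0..<n})" for x
  proof -
    have x': "x \<noteq> 0" "\<And>i. i < n \<Longrightarrow> x \<noteq> z (Suc i)" using x by auto
    have "P * mat_diag n (\<lambda>i. z (Suc i)) * P \<in> carrier_mat n n"
      unfolding P_def by (auto intro!: mult_carrier_mat[of _ n n])
    from poly_char_poly_eq_det[OF this, of x]
    have "poly ?p x = x * ((\<Prod>i = 0..<n. x - z (Suc i)) *
        (\<Sum>i = 0..<n. of_real (\<gamma> (Suc i)) / (x - z (Suc i))))"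
      using det_compression[OF s x'(1), of "\<lambda>i. z (Suc i)"] x'(2) sq by (simp add: P_def)
    then show ?thesis using poly_incomplete_comb[of n x z \<gamma>] x'(2) by simp
  qed
  then have "- insert 0 ((\<lambda>i. z (Suc i)) ` {0..<n}) \<subseteq> {x. poly (?p - ?q) x = 0}" by blast
  then have "finite (- insert 0 ((\<lambda>i. z (Suc i)) ` {0..<n}))" using fin finite_subset by blast
  then have "finite (UNIV :: complex set)"
    using finite_compl by (metis finite_imageI finite_atLeastLessThan finite_insert)
  then show False by (simp add: infinite_UNIV_char_0)
qed

section \<open>From zero listings to the product inequality\<close>

text \<open>Puts the zeros into the 0-based list form of the eigenvalue lemma. The factor
  \<open>[:0, 1:]\<close> supplies the eigenvalue 0, placed in the last slot
  \<open>n - 1\<close>.\<close>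

lemma incomplete_comb_factorization:
  assumes n: "n \<ge> 1" and g1: "(\<Sum>k = 1..n. \<gamma> k) = 1"
    and w: "zeros_listing (incomplete_comb n \<gamma> z) (n - 1) w"
  shows "[:0, 1:] * incomplete_comb n \<gamma> z =
    (\<Prod>a\<leftarrow>map (\<lambda>i. if i < n - 1 then w (Suc i) else 0) [0..<n]. [:- a, 1:])"
proof -
  have "incomplete_comb n \<gamma> z = (\<Prod>a\<in>#proots (incomplete_comb n \<gamma> z). [:- a, 1:])"
    using complex_poly_decompose_multiset[of "incomplete_comb n \<gamma> z"]
    by (simp add: incomplete_comb_monic(2)[OF n g1])
  also have "\<dots> = (\<Prod>j = 1..n - 1. [:- w j, 1:])"
    using w by (simp add: zeros_listing_def prod_unfold_prod_mset image_mset.compositionality o_def)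
  also have "\<dots> = (\<Prod>i = 0..<n - 1. [:- w (Suc i), 1:])"
    by (simp add: prod.atLeast1_atMost_eq atLeast0LessThan)
  finally have "[:0, 1:] * incomplete_comb n \<gamma> z = [:0, 1:] * (\<Prod>i = 0..<n - 1. [:- w (Suc i), 1:])"
    by simp
  also have "\<dots> = (\<Prod>i = 0..<Suc (n - 1). [:- (if i < n - 1 then w (Suc i) else 0), 1:])"
    by simp
  also have "\<dots> = (\<Prod>i = 0..<n. [:- (if i < n - 1 then w (Suc i) else 0), 1:])"
    using n by simp
  finally show ?thesis
    by (simp add: prod.distinct_set_conv_list[of "[0..<n]", simplified] o_def)
qed

theorem theorem1p7:
  fixes n :: nat and z :: "nat \<Rightarrow> complex" and \<gamma> :: "nat \<Rightarrow> real"
    and w :: "nat \<Rightarrow> complex" and v :: "nat \<Rightarrow> real"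
  assumes "n \<ge> 2"
    and "\<And>k. k \<in> {1..n} \<Longrightarrow> \<gamma> k \<ge> 0"
    and "(\<Sum>k = 1..n. \<gamma> k) = 1"
    and "zeros_listing (incomplete_comb n \<gamma> z) (n - 1) w"
    and "\<And>i j. 1 \<le> i \<Longrightarrow> i \<le> j \<Longrightarrow> j \<le> n - 1 \<Longrightarrow> cmod (w j) \<le> cmod (w i)"
    and "zeros_listing (incomplete_comb n \<gamma> (\<lambda>j. of_real (cmod (z j)))) (n - 1)
           (\<lambda>j. of_real (v j))"
    and "\<And>i j. 1 \<le> i \<Longrightarrow> i \<le> j \<Longrightarrow> j \<le> n - 1 \<Longrightarrow> v j \<le> v i"
  shows "\<forall>k. 1 \<le> k \<and> k \<le> n - 1 \<longrightarrow> (\<Prod>j = 1..k. cmod (w j)) \<le> (\<Prod>j = 1..k. \<bar>v j\<bar>)"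
proof (intro allI impI)
  fix k assume k: "1 \<le> k \<and> k \<le> n - 1"
  have n1: "n \<ge> 1" using assms(1) by simp
  define P where "P = complement_proj n (\<lambda>i. sqrt (\<gamma> (Suc i)))"
  \<comment> \<open>The padded 0 sits at index \<open>n - 1\<close>, beyond the first
    \<open>k\<close> entries since \<open>k \<le> n - 1\<close>. As the \<open>v j\<close> are
    nonnegative, it keeps \<open>?e\<close> descending.\<close>
  let ?l = "\<lambda>i. if i < n - 1 then w (Suc i) else 0"
  let ?e = "\<lambda>i. if i < n - 1 then v (Suc i) else 0"
  let ?B = "incomplete_comb n \<gamma> (\<lambda>j. of_real (cmod (z j)))"
  have v0: "0 \<le> v j" if j: "j \<in> {1..n - 1}" for j
  proof -
    have "complex_of_real (v j) \<in># proots ?B"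
      using assms(6) j by (simp add: zeros_listing_def)
    then have "poly ?B (of_real (v j)) = 0"
      using incomplete_comb_monic(3)[OF n1 assms(3)] by simp
    then show ?thesis
      using incomplete_comb_moduli_zero[OF n1 assms(2,3)] by fastforce
  qed
  have "(\<Prod>i = 0..<k. cmod (?l i)) \<le> (\<Prod>i = 0..<k. ?e i)"
  proof (rule prod_eigenvalues_compression_le)
    show "P \<in> carrier_mat n n" "mat_adjoint P = P"
      by (auto simp: P_def complement_proj_def of_bool_def intro!: eq_matI)
    show "char_poly (P * mat_diag n (\<lambda>i. z (Suc i)) * P) = (\<Prod>a\<leftarrow>map ?l [0..<n]. [:- a, 1:])"
      using char_poly_compression[OF assms(2,3), of z]
        incomplete_comb_factorization[OF n1 assms(3,4)] unfolding P_def by simp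
    have "(\<lambda>i. complex_of_real (?e i)) = (\<lambda>i. if i < n - 1 then of_real (v (Suc i)) else 0)"
      by auto
    then show "char_poly (P * mat_diag n (\<lambda>i. of_real (cmod (z (Suc i)))) * P) =
        (\<Prod>a\<leftarrow>map (\<lambda>i. of_real (?e i)) [0..<n]. [:- a, 1:])"
      using char_poly_compression[OF assms(2,3), of "\<lambda>j. of_real (cmod (z j))"]
        incomplete_comb_factorization[OF n1 assms(3,6)] unfolding P_def by simp
    show "0 \<le> ?e j \<and> ?e j \<le> ?e i" if "i \<le> j" "j < n" for i j
      using that v0[of "Suc j"] v0[of "Suc i"] assms(7)[of "Suc i" "Suc j"] by auto
    show "k \<le> n" using k by linarith
  qed
  moreover have "(\<Prod>i = 0..<k. cmod (?l i)) = (\<Prod>j = 1..k. cmod (w j))"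
    using k by (auto simp: prod.atLeast1_atMost_eq atLeast0LessThan intro!: prod.cong)
  moreover have "(\<Prod>i = 0..<k. ?e i) = (\<Prod>j = 1..k. \<bar>v j\<bar>)"
    using k v0 by (auto simp: prod.atLeast1_atMost_eq atLeast0LessThan intro!: prod.cong)
  ultimately show "(\<Prod>j = 1..k. cmod (w j)) \<le> (\<Prod>j = 1..k. \<bar>v j\<bar>)" by simp
qed

end
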